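(* For every $\alpha>0$ there exist $\kappa>0$ (depending on $\alpha$) and a sequence $(\tau_n)_{n\in\mathcal S'}$ of almost periods of the Arithmetic Random Wave such that, for all sufficiently large $n\in\mathcal S'$, $$|\tau_n|\le \exp\left(\mathcal N_n^{1+\alpha}\right)n^{-1/2}$$ and $$\varepsilon_n:=\sup_{t\in\mathbb T^2}|r_n(t+\tau_n)-r_n(t)|\le e^{-\log(n)^{\kappa}} .$$
   Context: $\mathbb T^2=\mathbb R^2/\mathbb Z^2$, and for $\tau\in\mathbb T^2$, $|\tau|$ is the Euclidean distance from $\tau$ to $0$ in $\mathbb T^2$. $\mathcal S=\{a^2+b^2:(a,b)\in\mathbb Z^2\}$, $\Lambda_n=\{\lambda\in\mathbb Z^2:\lambda_1^2+\lambda_2^2=n\}$, $\mathcal N_n=\operatorname{card}\Lambda_n$. Arithmetic Random Wave: $T_n(t)=\frac1{\sqrt{\mathcal N_n}}\sum_{\lambda\in\Lambda_n}a_\lambda e^{2i\pi\langle\lambda,t\rangle}$, $t\in\mathbb T^2$, where the $a_\lambda$ are standard complex Gaussian variables, independent except for the relation $a_{-\lambda}=\overline{a_\lambda}$. It is a centered stationary real Gaussian process with covariance function $r_n(t)=\frac1{\mathcal N_n}\sum_{\lambda\in\Lambda_n}\cos(2\pi\langle\lambda,t\rangle)$. Standing assumption: $\mathcal S'\subset\mathcal S$ is a fixed subset of relative density $1$ in $\mathcal S$ such that, as $n\to\infty$ in $\mathcal S'$: (a) $\mathcal N_n=\log(n)^{\log(2)/2+o(1)}$, so that for every $0<\kappa'<\log(2)/2$,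 $\mathcal N_n\ge\log(n)^{\kappa'}$ for $n$ large; (b) the probability measures $\frac1{\mathcal N_n}\sum_{\lambda\in\Lambda_n}\delta_{\lambda/\sqrt n}$ converge weakly to the uniform probability measure $\sigma$ on the unit circle $\mathbb S^1$, and for every $\rho<\frac12\log(\pi/2)$ and $n$ large enough, $\sup_{\Gamma}\left|\frac1{\mathcal N_n}\operatorname{card}\{\lambda\in\Lambda_n:\lambda/\sqrt n\in\Gamma\}-\sigma(\Gamma)\right|\le\log(n)^{-\rho}$, the supremum being over arcs $\Gamma\subset\mathbb S^1$. All limits in $n$ are along $n\in\mathcal S'$. A sequence of almost periods of the Arithmetic Random Wave is a sequence $\tau_n\in\mathbb T^2$ such that almost surely $\sup_{t\in\mathbb T^2}|T_n(t+\tau_n)-T_n(t)|\to0$, and $\liminf\sqrt n\,|\tau_n|\ge1$. *)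

theory Defs
  imports "HOL-Probability.Probability"
begin

text \<open>
  Points of the torus \<open>\<real>\<^sup>2 / \<int>\<^sup>2\<close> are given by representatives in \<^typ>\<open>real \<times> real\<close> (whose norm is
  the Euclidean one). The functions on the torus considered here are \<open>\<int>\<^sup>2\<close>-periodic functions on
  \<^typ>\<open>real \<times> real\<close>, so suprema over the torus are suprema over all representatives.
\<close>

definition lattice_point :: "int \<times> int \<Rightarrow> real \<times> real" where
  "lattice_point l = (of_int (fst l), of_int (snd l))"

text \<open>Euclidean distance from the class of \<open>x\<close> to \<open>0\<close> in the torus.\<close>

definition torus_norm :: "real \<times> real \<Rightarrow> real" where
  "torus_norm x = infdist x (range lattice_point)"


definition sums_of_two_squares :: "nat set" where
  "sums_of_two_squares = {n. \<exists>a b :: int. int n = a\<^sup>2 + b\<^sup>2}"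

definition Lam :: "nat \<Rightarrow> (int \<times> int) set" where
  "Lam n = {l. (fst l)\<^sup>2 + (snd l)\<^sup>2 = int n}"

definition NN :: "nat \<Rightarrow> nat" where
  "NN n = card (Lam n)"

definition relative_density_one :: "nat set \<Rightarrow> nat set \<Rightarrow> bool" where
  "relative_density_one A B \<longleftrightarrow>
     (\<lambda>x. real (card (A \<inter> {..x})) / real (card (B \<inter> {..x}))) \<longlonglongrightarrow> 1"

text \<open>The filter for \<open>n\<close> tending to infinity inside \<open>A\<close>.\<close>

definition along :: "nat set \<Rightarrow> nat filter" where
  "along A = inf sequentially (principal A)"


text \<open>Measures on the circle are regarded as Borel measures on the plane carried by it.\<close>

definition circle_measure :: "(real \<times> real) measure" where
  "circle_measure =
     distr (uniform_measure lborel {0..<2 * pi}) borel (\<lambda>\<theta>. (cos \<theta>, sin \<theta>))"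

text \<open>The measure \<open>(1 / NN n) \<Sum>\<^bsub>l\<^esub> \<delta>\<^bsub>l / \<surd>n\<^esub>\<close>, as the law of \<open>l / \<surd>n\<close> for uniform \<open>l\<close> in \<open>Lam n\<close>.\<close>

definition empirical_measure :: "nat \<Rightarrow> (real \<times> real) measure" where
  "empirical_measure n =
     measure_pmf (map_pmf (\<lambda>l. lattice_point l /\<^sub>R sqrt (real n)) (pmf_of_set (Lam n)))"

definition converges_weakly ::
    "('i \<Rightarrow> 'a::topological_space measure) \<Rightarrow> 'a measure \<Rightarrow> 'i filter \<Rightarrow> bool" where
  "converges_weakly \<mu> \<nu> F \<longleftrightarrow>
     (\<forall>f :: 'a \<Rightarrow> real. continuous_on UNIV f \<and> bounded (range f) \<longrightarrow>
        ((\<lambda>n. integral\<^sup>L (\<mu> n) f) \<longlongrightarrow> integral\<^sup>L \<nu> f) F)"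

text \<open>Open, closed and half-open arcs are all allowed.\<close>

definition arcs :: "(real \<times> real) set set" where
  "arcs = {\<Gamma>. \<Gamma> \<subseteq> sphere 0 1 \<and> connected \<Gamma>}"

definition arc_discrepancy :: "nat \<Rightarrow> real" where
  "arc_discrepancy n =
     (SUP \<Gamma>\<in>arcs. \<bar>real (card {l \<in> Lam n. lattice_point l /\<^sub>R sqrt (real n) \<in> \<Gamma>}) / real (NN n)
                    - measure circle_measure \<Gamma>\<bar>)"


text \<open>Normalised so that \<open>E \<bar>X\<bar>\<^sup>2 = 1\<close>.\<close>

definition standard_complex_gaussian :: "'w measure \<Rightarrow> ('w \<Rightarrow> complex) \<Rightarrow> bool" where
  "standard_complex_gaussian M X \<longleftrightarrow>
     X \<in> borel_measurable M \<and>
     prob_space.indep_var M borel (\<lambda>\<omega>. Re (X \<omega>)) borel (\<lambda>\<omega>. Im (X \<omega>)) \<and>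
     distributed M lborel (\<lambda>\<omega>. Re (X \<omega>)) (normal_density 0 (1 / sqrt 2)) \<and>
     distributed M lborel (\<lambda>\<omega>. Im (X \<omega>)) (normal_density 0 (1 / sqrt 2))"

text \<open>
  Independence up to the relation \<open>a (- l) = cnj (a l)\<close>: every subfamily that contains at most one
  element of each pair \<open>{l, - l}\<close> is independent. Since the sets \<open>Lam n\<close> are pairwise disjoint,
  a single family \<open>a\<close> indexed by \<open>\<int>\<^sup>2\<close> carries the coefficients for all \<open>n\<close>; imposing this
  predicate for several \<open>n\<close> says nothing about the joint law of the coefficients for different \<open>n\<close>,
  so every coupling is covered, in particular the one where the whole family is independent.
\<close>

definition wave_coefficients ::
    "'w measure \<Rightarrow> (int \<times> int \<Rightarrow> 'w \<Rightarrow> complex) \<Rightarrow> nat \<Rightarrow> bool" where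
  "wave_coefficients M a n \<longleftrightarrow>
     prob_space M \<and>
     (\<forall>l\<in>Lam n. standard_complex_gaussian M (a l)) \<and>
     (\<forall>l\<in>Lam n. \<forall>\<omega>\<in>space M. a (- l) \<omega> = cnj (a l \<omega>)) \<and>
     (\<forall>H\<subseteq>Lam n. (\<forall>l\<in>H. - l \<notin> H) \<longrightarrow> prob_space.indep_vars M (\<lambda>_. borel) a H)"

text \<open>Complex-valued as written; real under the relation \<open>a (- l) = cnj (a l)\<close>.\<close>

definition random_wave ::
    "(int \<times> int \<Rightarrow> 'w \<Rightarrow> complex) \<Rightarrow> nat \<Rightarrow> 'w \<Rightarrow> real \<times> real \<Rightarrow> complex" where
  "random_wave a n \<omega> t =
     of_real (1 / sqrt (real (NN n))) *
     (\<Sum>l\<in>Lam n. a l \<omega> * exp (2 * \<i> * of_real pi * of_real (lattice_point l \<bullet> t)))"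

definition wave_cov :: "nat \<Rightarrow> real \<times> real \<Rightarrow> real" where
  "wave_cov n t = 1 / real (NN n) * (\<Sum>l\<in>Lam n. cos (2 * pi * (lattice_point l \<bullet> t)))"

text \<open>
  The suprema below, and in the definition of \<open>almost_periods\<close>, are over nonempty bounded sets of
  reals because \<open>Lam n\<close> is finite.
\<close>

definition cov_shift :: "nat \<Rightarrow> real \<times> real \<Rightarrow> real" where
  "cov_shift n \<tau> = (SUP t. \<bar>wave_cov n (t + \<tau>) - wave_cov n t\<bar>)"

text \<open>Only the values \<open>\<tau> n\<close> for \<open>n \<in> A\<close> matter.\<close>

definition almost_periods ::
    "nat set \<Rightarrow> 'w measure \<Rightarrow> (int \<times> int \<Rightarrow> 'w \<Rightarrow> complex) \<Rightarrow> (nat \<Rightarrow> real \<times> real) \<Rightarrow> bool" where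
  "almost_periods A M a \<tau> \<longleftrightarrow>
     (AE \<omega> in M.
        ((\<lambda>n. SUP t. cmod (random_wave a n \<omega> (t + \<tau> n) - random_wave a n \<omega> t)) \<longlongrightarrow> 0) (along A)) \<and>
     Liminf (along A) (\<lambda>n. ereal (sqrt (real n) * torus_norm (\<tau> n))) \<ge> 1"

end

theory Submission
  imports Defs "HOL-Analysis.Kronecker_Approximation_Theorem" "HOL-Real_Asymp.Real_Asymp"
begin

text \<open>
  A shift \<open>\<tau>\<close> moves the wave and its covariance by little as soon as every phase
  \<open>exp (2 \<pi> \<i> \<langle>l, \<tau>\<rangle>)\<close>, \<open>l \<in> Lam n\<close>, is close to \<open>1\<close>. Among the multiples
  \<open>m (1, 0) / \<surd>n\<close>, the pigeonhole principle in a torus of dimension \<open>NN n\<close> (Dirichlet's simultaneous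
  approximation) provides one with \<open>1 \<le> m \<le> Q ^ NN n\<close> for which all phases are within
  \<open>2 \<pi> / Q\<close> of \<open>1\<close>. Taking \<open>Q\<close> about \<open>exp (NN n powr \<alpha>)\<close> makes
  \<open>Q ^ NN n \<le> exp (NN n powr (1 + \<alpha>))\<close>, the required bound on the length of the shift, and since
  \<open>NN n\<close> exceeds a fixed power of \<open>ln n\<close>, the error \<open>2 \<pi> / Q\<close> is at most
  \<open>exp (- (ln n powr \<kappa>))\<close>.

  Two points remain. The shift must not be small in the torus, that is, the walk along the multiples
  of \<open>(1, 0) / \<surd>n\<close> must not come back close to an integer point. The statement for a smaller
  \<open>\<alpha>\<close> is stronger, so one may assume \<open>\<alpha> \<le> 1\<close>; as \<open>NN n\<close> is about \<open>ln n powr (ln 2 / 2)\<close>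
  and \<open>ln 2 < 1\<close>, then \<open>exp (NN n powr (1 + \<alpha>))\<close> is much smaller than \<open>\<surd>n\<close>, and the walk never
  gets halfway around the torus (\<open>torus_norm_horizontal\<close>).

  Moreover, the bound for the wave involves its random coefficients. By Gaussian tail bounds and the
  Borel--Cantelli lemma, almost surely all coefficients with index in \<open>Lam n\<close> are at most
  \<open>4 sqrt (ln n)\<close> for \<open>n\<close> large (\<open>AE_eventually_coefficients_le\<close>); such a factor is negligible
  against \<open>exp (- (ln n powr \<kappa>))\<close>.
\<close>

section \<open>Deterministic bounds for shifts\<close>

lemma Lam_subset: "Lam n \<subseteq> {- int n..int n} \<times> {- int n..int n}"
proof
  fix l assume l: "l \<in> Lam n"
  have *: "\<bar>x\<bar> \<le> int n" if "x\<^sup>2 \<le> int n" for x :: int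
  proof -
    have "\<bar>x\<bar> * 1 \<le> \<bar>x\<bar> * \<bar>x\<bar>"
      by (cases "x = 0") (simp_all only: mult_le_cancel_left, auto)
    hence "\<bar>x\<bar> \<le> x\<^sup>2" by (simp add: power2_eq_square)
    with that show ?thesis by linarith
  qed
  have "(fst l)\<^sup>2 \<le> int n" "(snd l)\<^sup>2 \<le> int n"
    using l zero_le_power2[of "fst l"] zero_le_power2[of "snd l"]
    unfolding Lam_def mem_Collect_eq by linarith+
  from this[THEN *] show "l \<in> {- int n..int n} \<times> {- int n..int n}"
    by (cases l) auto
qed

lemma finite_Lam: "finite (Lam n)"
  by (rule finite_subset[OF Lam_subset]) auto

lemma card_Lam_le: "card (Lam n) \<le> (2 * n + 1)\<^sup>2"
proof -
  have "card (Lam n) \<le> card ({- int n..int n} \<times> {- int n..int n})"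
    by (rule card_mono[OF _ Lam_subset]) auto
  also have "\<dots> = (2 * n + 1)\<^sup>2"
    by (simp add: card_cartesian_product power2_eq_square nat_add_distrib nat_mult_distrib)
  finally show ?thesis .
qed

definition phase :: "int \<times> int \<Rightarrow> real \<times> real \<Rightarrow> complex" where
  "phase l t = exp (2 * \<i> * of_real pi * of_real (lattice_point l \<bullet> t))"

lemma phase_cis: "phase l t = cis (2 * pi * (lattice_point l \<bullet> t))"
  by (simp add: phase_def cis_conv_exp algebra_simps)

lemma norm_phase [simp]: "cmod (phase l t) = 1"
  by (simp add: phase_cis)

lemma phase_add: "phase l (s + t) = phase l s * phase l t"
  by (simp add: phase_cis cis_mult inner_add_right distrib_left)

lemma norm_phase_shift: "cmod (phase l (t + \<tau>) - phase l t) = cmod (phase l \<tau> - 1)"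
proof -
  have "phase l (t + \<tau>) - phase l t = phase l t * (phase l \<tau> - 1)"
    by (simp add: phase_add algebra_simps)
  thus ?thesis by (simp add: norm_mult)
qed

lemma phase_near_one:
  fixes k :: int
  assumes "\<bar>lattice_point l \<bullet> t - of_int k\<bar> \<le> \<delta>"
  shows "cmod (phase l t - 1) \<le> 2 * pi * \<delta>"
proof -
  define y where "y = 2 * pi * (lattice_point l \<bullet> t - of_int k)"
  have "phase l t = cis (y + 2 * pi * of_int k)"
    unfolding phase_cis y_def by (simp add: algebra_simps)
  also have "\<dots> = exp (\<i> * of_real y)"
    unfolding cis_mult[symmetric] by (subst cis_multiple_2pi) (simp_all add: cis_conv_exp)
  finally have "cmod (phase l t - 1) = 2 * \<bar>sin (y / 2)\<bar>"
    by (simp only: dist_exp_i_1)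
  also have "\<dots> \<le> \<bar>y\<bar>"
    using abs_sin_x_le_abs_x[of "y / 2"] by simp
  also have "\<dots> \<le> 2 * pi * \<delta>"
    using assms by (simp add: y_def abs_mult)
  finally show ?thesis .
qed

lemma common_near_period:
  fixes L :: "(int \<times> int) set" and v :: "real \<times> real" and Q :: nat
  assumes "finite L" "Q > 0"
  obtains m :: nat where "1 \<le> m" "m \<le> Q ^ card L"
    "\<And>l. l \<in> L \<Longrightarrow> cmod (phase l (real m *\<^sub>R v) - 1) \<le> 2 * pi / real Q"
proof -
  obtain f where f: "bij_betw f {0..<card L} L"
    using ex_bij_betw_nat_finite[OF \<open>finite L\<close>] by blast
  obtain q p where q: "0 < q" "q \<le> int (Q ^ card L)"
    and qp: "\<And>i. i < card L \<Longrightarrow>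
      \<bar>of_int q * (lattice_point (f i) \<bullet> v) - of_int (p i)\<bar> < 1 / real Q"
    using Dirichlet_approx_simult[OF \<open>Q > 0\<close>, of "card L" "\<lambda>i. lattice_point (f i) \<bullet> v"] by metis
  show thesis
  proof (rule that[of "nat q"])
    show "1 \<le> nat q" "nat q \<le> Q ^ card L"
      using q by (linarith, simp add: nat_le_iff)
  next
    fix l assume "l \<in> L"
    with f obtain i where i: "i < card L" "l = f i"
      by (metis atLeastLessThan_iff bij_betw_def imageE)
    have "\<bar>lattice_point l \<bullet> (real (nat q) *\<^sub>R v) - of_int (p i)\<bar> \<le> 1 / real Q"
      using qp[OF i(1)] q(1) i(2) by simp
    from phase_near_one[OF this]
    show "cmod (phase l (real (nat q) *\<^sub>R v) - 1) \<le> 2 * pi / real Q" by simp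
  qed
qed

lemma cov_shift_le:
  assumes "NN n > 0" and phases: "\<And>l. l \<in> Lam n \<Longrightarrow> cmod (phase l \<tau> - 1) \<le> \<delta>"
  shows "cov_shift n \<tau> \<le> \<delta>"
  unfolding cov_shift_def
proof (rule cSUP_least)
  fix t
  have cos_phase: "cos (2 * pi * (lattice_point l \<bullet> x)) = Re (phase l x)" for l x
    by (simp add: phase_cis)
  have "\<bar>wave_cov n (t + \<tau>) - wave_cov n t\<bar>
      = (1 / real (NN n)) * \<bar>\<Sum>l\<in>Lam n. Re (phase l (t + \<tau>) - phase l t)\<bar>"
    unfolding wave_cov_def cos_phase
    by (simp add: sum_subtractf flip: right_diff_distrib diff_divide_distrib)
  also have "\<dots> \<le> (1 / real (NN n)) * (\<Sum>l\<in>Lam n. \<delta>)"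
  proof (intro mult_left_mono order_trans[OF sum_abs] sum_mono)
    fix l assume "l \<in> Lam n"
    have "\<bar>Re (phase l (t + \<tau>) - phase l t)\<bar> \<le> cmod (phase l (t + \<tau>) - phase l t)"
      by (rule abs_Re_le_cmod)
    thus "\<bar>Re (phase l (t + \<tau>) - phase l t)\<bar> \<le> \<delta>"
      using phases[OF \<open>l \<in> Lam n\<close>] by (simp add: norm_phase_shift)
  qed simp
  also have "\<dots> = \<delta>"
    using assms(1) by (simp add: NN_def)
  finally show "\<bar>wave_cov n (t + \<tau>) - wave_cov n t\<bar> \<le> \<delta>" .
qed simp

lemma random_wave_shift_le:
  assumes "NN n > 0" and phases: "\<And>l. l \<in> Lam n \<Longrightarrow> cmod (phase l \<tau> - 1) \<le> \<delta>"
    and coeffs: "\<And>l. l \<in> Lam n \<Longrightarrow> cmod (a l \<omega>) \<le> B"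
    and "\<delta> \<ge> 0"
  shows "cmod (random_wave a n \<omega> (t + \<tau>) - random_wave a n \<omega> t) \<le> sqrt (real (NN n)) * B * \<delta>"
proof -
  have "random_wave a n \<omega> (t + \<tau>) - random_wave a n \<omega> t
      = of_real (1 / sqrt (real (NN n))) * (\<Sum>l\<in>Lam n. a l \<omega> * (phase l (t + \<tau>) - phase l t))"
    unfolding random_wave_def phase_def[symmetric]
    by (simp add: sum_subtractf right_diff_distrib diff_divide_distrib)
  hence "cmod (random_wave a n \<omega> (t + \<tau>) - random_wave a n \<omega> t)
      = 1 / sqrt (real (NN n)) * cmod (\<Sum>l\<in>Lam n. a l \<omega> * (phase l (t + \<tau>) - phase l t))"
    by (simp add: norm_mult norm_divide)
  also have "\<dots> \<le> 1 / sqrt (real (NN n)) * (\<Sum>l\<in>Lam n. B * \<delta>)"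
  proof (intro mult_left_mono order_trans[OF norm_sum] sum_mono)
    fix l assume l: "l \<in> Lam n"
    show "cmod (a l \<omega> * (phase l (t + \<tau>) - phase l t)) \<le> B * \<delta>"
      unfolding norm_mult norm_phase_shift
      by (rule mult_mono[OF coeffs[OF l] phases[OF l]])
        (use order_trans[OF norm_ge_zero coeffs[OF l]] in auto)
  qed simp
  also have "\<dots> = sqrt (real (NN n)) * B * \<delta>"
    using assms(1) by (simp add: NN_def real_div_sqrt field_simps)
  finally show ?thesis .
qed

lemma torus_norm_le_norm: "torus_norm x \<le> norm x"
proof -
  have "lattice_point 0 = 0" by (simp add: lattice_point_def zero_prod_def)
  hence "0 \<in> range lattice_point" by (metis rangeI)
  thus ?thesis unfolding torus_norm_def using infdist_le[of 0 _ x] by simp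
qed

lemma torus_norm_horizontal:
  assumes "0 \<le> x" "x \<le> 1 / 2"
  shows "torus_norm (x, 0) = x"
proof (rule antisym)
  show "torus_norm (x, 0) \<le> x"
    using torus_norm_le_norm[of "(x, 0)"] assms by (simp add: norm_Pair)
  have "x \<le> dist (x, 0) (lattice_point l)" for l
  proof -
    have "x \<le> \<bar>x - of_int (fst l)\<bar>"
    proof (cases "fst l \<le> 0")
      case True
      hence "real_of_int (fst l) \<le> 0" by simp
      thus ?thesis by linarith
    next
      case False
      hence "1 \<le> real_of_int (fst l)" by linarith
      thus ?thesis using assms by linarith
    qed
    also have "\<dots> \<le> dist (x, 0) (lattice_point l)"
      using dist_fst_le[of "(x, 0 :: real)" "lattice_point l"]
      by (simp add: lattice_point_def dist_real_def)
    finally show ?thesis .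
  qed
  thus "x \<le> torus_norm (x, 0)"
    unfolding torus_norm_def infdist_def by (auto intro!: cINF_greatest)
qed


section \<open>The size of the Gaussian coefficients\<close>

text \<open>
  Chernoff's method: multiplying the density by \<open>exp (s x)\<close> only translates it by
  \<open>s \<sigma>\<^sup>2\<close> and scales it by \<open>exp (s\<^sup>2 \<sigma>\<^sup>2 / 2)\<close>, and \<open>s = c / \<sigma>\<^sup>2\<close> is the best parameter.
\<close>

lemma (in prob_space) normal_upper_tail:
  assumes X: "distributed M lborel X (normal_density 0 \<sigma>)" and "\<sigma> > 0" "c > 0"
  shows "prob {\<omega> \<in> space M. X \<omega> \<ge> c} \<le> exp (- c\<^sup>2 / (2 * \<sigma>\<^sup>2))"
proof -
  define s where "s = c / \<sigma>\<^sup>2"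
  have "s > 0" using assms by (simp add: s_def)
  have s\<sigma>: "s * \<sigma>\<^sup>2 = c" using assms by (simp add: s_def)
  have tilt: "normal_density 0 \<sigma> x * exp (s * x) = exp (s * c / 2) * normal_density c \<sigma> x" for x
  proof -
    have "- x\<^sup>2 / (2 * \<sigma>\<^sup>2) + s * x = s * c / 2 + (- (x - c)\<^sup>2 / (2 * \<sigma>\<^sup>2))"
      using \<open>\<sigma> > 0\<close> by (simp add: s_def field_simps power2_eq_square)
    hence "exp (- x\<^sup>2 / (2 * \<sigma>\<^sup>2)) * exp (s * x) = exp (s * c / 2) * exp (- (x - c)\<^sup>2 / (2 * \<sigma>\<^sup>2))"
      by (simp only: exp_add[symmetric])
    thus ?thesis unfolding normal_density_def by simp
  qed
  have int: "integrable M (\<lambda>\<omega>. exp (s * X \<omega>))"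
    by (subst distributed_integrable[OF X, symmetric]) (use \<open>\<sigma> > 0\<close> in \<open>auto simp: tilt\<close>)
  have "expectation (\<lambda>\<omega>. exp (s * X \<omega>)) = (\<integral>x. normal_density 0 \<sigma> x * exp (s * x) \<partial>lborel)"
    by (subst distributed_integral[OF X, symmetric]) auto
  also have "\<dots> = exp (s * c / 2)"
    using \<open>\<sigma> > 0\<close> by (simp add: tilt)
  finally have mgf: "expectation (\<lambda>\<omega>. exp (s * X \<omega>)) = exp (s * c / 2)" .
  have [measurable]: "X \<in> borel_measurable M"
    using distributed_measurable[OF X] by simp
  have "prob {\<omega> \<in> space M. X \<omega> \<ge> c} = prob {\<omega> \<in> space M. exp (s * X \<omega>) \<ge> exp (s * c)}"
    using \<open>s > 0\<close> by simp
  also have "\<dots> \<le> exp (s * c / 2) / exp (s * c)"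
    using integral_Markov_inequality_measure[OF int, of "{}" "exp (s * c)"] by (simp add: mgf)
  also have "\<dots> = exp (- (s * c / 2))"
    by (simp flip: exp_diff)
  also have "s * c / 2 = c\<^sup>2 / (2 * \<sigma>\<^sup>2)"
    by (simp add: s_def power2_eq_square)
  finally show ?thesis by simp
qed

lemma (in prob_space) normal_tail:
  assumes X: "distributed M lborel X (normal_density 0 \<sigma>)" and "\<sigma> > 0" "c > 0"
  shows "prob {\<omega> \<in> space M. \<bar>X \<omega>\<bar> \<ge> c} \<le> 2 * exp (- c\<^sup>2 / (2 * \<sigma>\<^sup>2))"
proof -
  have X': "distributed M lborel (\<lambda>\<omega>. - X \<omega>) (normal_density 0 \<sigma>)"
    using normal_density_affine[OF X \<open>\<sigma> > 0\<close>, of "-1" 0] by simp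
  have [measurable]: "X \<in> borel_measurable M"
    using distributed_measurable[OF X] by simp
  have "{\<omega> \<in> space M. \<bar>X \<omega>\<bar> \<ge> c} = {\<omega> \<in> space M. X \<omega> \<ge> c} \<union> {\<omega> \<in> space M. - X \<omega> \<ge> c}"
    by auto
  also have "prob \<dots> \<le> prob {\<omega> \<in> space M. X \<omega> \<ge> c} + prob {\<omega> \<in> space M. - X \<omega> \<ge> c}"
    by (rule measure_Un_le) measurable
  finally show ?thesis
    using normal_upper_tail[OF X assms(2,3)] normal_upper_tail[OF X' assms(2,3)] by linarith
qed

lemma (in prob_space) standard_complex_gaussian_tail:
  assumes "standard_complex_gaussian M Z" "c > 0"
  shows "prob {\<omega> \<in> space M. cmod (Z \<omega>) \<ge> 2 * c} \<le> 4 * exp (- c\<^sup>2)"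
proof -
  have Z [measurable]: "Z \<in> borel_measurable M"
    and Re: "distributed M lborel (\<lambda>\<omega>. Re (Z \<omega>)) (normal_density 0 (1 / sqrt 2))"
    and Im: "distributed M lborel (\<lambda>\<omega>. Im (Z \<omega>)) (normal_density 0 (1 / sqrt 2))"
    using assms(1) by (auto simp: standard_complex_gaussian_def)
  have "prob {\<omega> \<in> space M. cmod (Z \<omega>) \<ge> 2 * c}
      \<le> prob ({\<omega> \<in> space M. \<bar>Re (Z \<omega>)\<bar> \<ge> c} \<union> {\<omega> \<in> space M. \<bar>Im (Z \<omega>)\<bar> \<ge> c})"
  proof (rule finite_measure_mono)
    show "{\<omega> \<in> space M. cmod (Z \<omega>) \<ge> 2 * c}
        \<subseteq> {\<omega> \<in> space M. \<bar>Re (Z \<omega>)\<bar> \<ge> c} \<union> {\<omega> \<in> space M. \<bar>Im (Z \<omega>)\<bar> \<ge> c}"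
    proof
      fix \<omega> assume "\<omega> \<in> {\<omega> \<in> space M. cmod (Z \<omega>) \<ge> 2 * c}"
      thus "\<omega> \<in> {\<omega> \<in> space M. \<bar>Re (Z \<omega>)\<bar> \<ge> c} \<union> {\<omega> \<in> space M. \<bar>Im (Z \<omega>)\<bar> \<ge> c}"
        using cmod_le[of "Z \<omega>"] by (auto simp: not_le)
    qed
  qed measurable
  also have "\<dots> \<le> prob {\<omega> \<in> space M. \<bar>Re (Z \<omega>)\<bar> \<ge> c} + prob {\<omega> \<in> space M. \<bar>Im (Z \<omega>)\<bar> \<ge> c}"
    by (rule measure_Un_le) measurable
  also have "\<dots> \<le> 2 * exp (- c\<^sup>2) + 2 * exp (- c\<^sup>2)"
    using normal_tail[OF Re _ \<open>c > 0\<close>] normal_tail[OF Im _ \<open>c > 0\<close>]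
    by (intro add_mono) (simp_all add: power_divide)
  finally show ?thesis by simp
qed

lemma eventually_along: "eventually P (along A) \<longleftrightarrow> eventually (\<lambda>n. n \<in> A \<longrightarrow> P n) sequentially"
  by (simp add: along_def eventually_inf_principal)

text \<open>
  Each coefficient exceeds \<open>4 sqrt (ln n)\<close> with probability at most \<open>4 / n ^ 4\<close>, and there are only
  \<open>O(n\<^sup>2)\<close> of them, so the Borel--Cantelli lemma applies.
\<close>

lemma (in prob_space) AE_eventually_coefficients_le:
  assumes gauss: "\<And>n l. n \<in> A \<Longrightarrow> n > 0 \<Longrightarrow> l \<in> Lam n \<Longrightarrow> standard_complex_gaussian M (a l)"
  shows "AE \<omega> in M. \<forall>\<^sub>F n in along A. \<forall>l\<in>Lam n. cmod (a l \<omega>) \<le> 4 * sqrt (ln (real n))"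
proof -
  define E where "E l n = {\<omega> \<in> space M. cmod (a l \<omega>) \<ge> 2 * (2 * sqrt (ln (real n)))}" for l n
  \<comment> \<open>at \<open>n = 1\<close> the threshold vanishes, and the tail bound needs a positive one\<close>
  define B where "B n = (if n \<in> A \<and> n > 1 then \<Union>l\<in>Lam n. E l n else {})" for n
  have E_sets: "E l n \<in> sets M" if "n \<in> A" "n > 1" "l \<in> Lam n" for l n
  proof -
    have [measurable]: "a l \<in> borel_measurable M"
      using gauss[of n l] that by (simp add: standard_complex_gaussian_def)
    show ?thesis unfolding E_def by measurable
  qed
  hence B_sets: "B n \<in> sets M" for n
    unfolding B_def using finite_Lam by auto
  have bound: "prob (B n) \<le> 36 * (1 / real n ^ 2)" for n
  proof (cases "n \<in> A \<and> n > 1")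
    case True
    hence ln: "ln (real n) > 0" by simp
    have "prob (B n) \<le> (\<Sum>l\<in>Lam n. prob (E l n))"
      unfolding B_def using True E_sets by (auto intro!: measure_UNION_le finite_Lam)
    also have "\<dots> \<le> (\<Sum>l\<in>Lam n. 4 * (1 / real n ^ 4))"
    proof (rule sum_mono)
      fix l assume l: "l \<in> Lam n"
      have "prob (E l n) \<le> 4 * exp (- (2 * sqrt (ln (real n)))\<^sup>2)"
        unfolding E_def using gauss[OF _ _ l] True ln
        by (intro standard_complex_gaussian_tail) auto
      also have "exp (- (2 * sqrt (ln (real n)))\<^sup>2) = inverse (exp (4 * ln (real n)))"
        using ln by (simp add: power_mult_distrib exp_minus)
      also have "exp (4 * ln (real n)) = real n ^ 4"
        using True exp_of_nat_mult[of 4 "ln (real n)"] by simp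
      finally show "prob (E l n) \<le> 4 * (1 / real n ^ 4)"
        by (simp add: divide_inverse)
    qed
    also have "\<dots> \<le> real (9 * n\<^sup>2) * (4 * (1 / real n ^ 4))"
    proof -
      have "card (Lam n) \<le> (3 * n)\<^sup>2"
        by (rule order_trans[OF card_Lam_le power_mono]) (use True in auto)
      hence "real (card (Lam n)) \<le> real (9 * n\<^sup>2)"
        by (simp only: of_nat_le_iff power_mult_distrib) simp
      hence "real (card (Lam n)) * (4 * (1 / real n ^ 4)) \<le> real (9 * n\<^sup>2) * (4 * (1 / real n ^ 4))"
        by (rule mult_right_mono) simp
      thus ?thesis by (simp only: sum_constant)
    qed
    also have "\<dots> = 36 * (1 / real n ^ 2)"
      using True by (simp add: field_simps eval_nat_numeral)
    finally show ?thesis .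
  qed (auto simp: B_def)
  have "summable (\<lambda>n. prob (B n))"
  proof (rule summable_comparison_test'[where N = 0])
    show "summable (\<lambda>n. 36 * (1 / real n ^ 2))"
      using inverse_power_summable[of 2, where 'a = real]
      by (intro summable_mult) (simp add: divide_inverse)
  qed (use bound in simp)
  hence "AE \<omega> in M. eventually (\<lambda>n. \<omega> \<in> space M - B n) sequentially"
    using B_sets by (intro borel_cantelli_AE1) (auto simp: less_top[symmetric])
  thus ?thesis
  proof (rule AE_mp, intro AE_I2 impI)
    fix \<omega> assume "\<omega> \<in> space M" and "eventually (\<lambda>n. \<omega> \<in> space M - B n) sequentially"
    from this(2) show "\<forall>\<^sub>F n in along A. \<forall>l\<in>Lam n. cmod (a l \<omega>) \<le> 4 * sqrt (ln (real n))"
      unfolding eventually_along using eventually_gt_at_top[of 1]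
      by eventually_elim (auto simp: B_def E_def split: if_splits)
  qed
qed


section \<open>Almost periods\<close>

text \<open>
  The exponents \<open>3 / 10\<close> and \<open>2 / 5\<close> enclose \<open>ln 2 / 2\<close>. What matters is that the first is positive
  and that the second is below \<open>1 / 2\<close>: then even \<open>(NN n)\<^sup>2\<close> is negligible against \<open>ln n\<close>.
\<close>

lemma NN_polylog_bounds:
  assumes "(h \<longlongrightarrow> 0) (along A)"
    and "\<forall>\<^sub>F n in along A. real (NN n) = ln (real n) powr (ln 2 / 2 + h n)"
  shows "\<forall>\<^sub>F n in along A. ln (real n) powr (3 / 10) \<le> real (NN n) \<and>
                          real (NN n) \<le> ln (real n) powr (2 / 5)"
proof -
  have h: "\<forall>\<^sub>F n in along A. \<bar>h n\<bar> < 1 / 40"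
    using tendstoD[OF assms(1), of "1 / 40"] by simp
  have "\<forall>\<^sub>F n in sequentially. ln (real n) \<ge> 1" by real_asymp
  hence "\<forall>\<^sub>F n in along A. ln (real n) \<ge> 1"
    unfolding eventually_along by (rule eventually_mono) simp
  with h assms(2) show ?thesis
  proof eventually_elim
    case (elim n)
    have "3 / 10 \<le> ln 2 / 2 + h n" "ln 2 / 2 + h n \<le> 2 / 5"
      using elim(1) ln2_ge_two_thirds ln2_le_25_over_36 by (simp_all add: abs_less_iff)
    thus ?case using elim by (simp add: powr_mono)
  qed
qed

text \<open>
  In the application \<open>x = ln n\<close> and \<open>N = NN n\<close>, and \<open>2 \<pi> / Q\<close> is the accuracy of the phases.
  The assumption \<open>b \<le> 1\<close> is what keeps \<open>Q ^ N\<close> below \<open>\<surd>n / 2\<close>. In the last bound any exponent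
  below \<open>3 b / 10\<close> would do; with \<open>b / 10\<close> it compares \<open>y ^ 3\<close> to \<open>y\<close> for \<open>y = x powr (b / 10)\<close>.
\<close>

lemma pigeonhole_parameter:
  fixes b :: real
  assumes "0 < b" "b \<le> 1"
  shows "\<forall>\<^sub>F x :: real in at_top. \<forall>N :: nat. x powr (3 / 10) \<le> real N \<and> real N \<le> x powr (2 / 5) \<longrightarrow>
    N > 0 \<and>
    (\<exists>Q > 0. real (Q ^ N) \<le> exp (real N powr (1 + b)) \<and> real (Q ^ N) \<le> exp (x / 2) / 2 \<and>
             2 * pi / real Q \<le> exp (- (x powr (b / 10))))"
proof -
  have "\<forall>\<^sub>F x :: real in at_top. x \<ge> 1"
    by real_asymp
  moreover have "\<forall>\<^sub>F x :: real in at_top. exp (x powr (4 / 5)) \<le> exp (x / 2) / 2"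
    by real_asymp
  moreover have "\<forall>\<^sub>F x :: real in at_top.
      4 * pi * exp (- (x powr (3 * b / 10))) \<le> exp (- (x powr (b / 10)))"
  proof -
    have "\<forall>\<^sub>F y :: real in at_top. 4 * pi * exp (- (y ^ 3)) \<le> exp (- y)"
      by real_asymp
    moreover have "filterlim (\<lambda>x :: real. x powr (b / 10)) at_top at_top"
      using \<open>0 < b\<close> by real_asymp
    ultimately have "\<forall>\<^sub>F x :: real in at_top.
        4 * pi * exp (- ((x powr (b / 10)) ^ 3)) \<le> exp (- (x powr (b / 10)))"
      by (rule eventually_compose_filterlim)
    moreover have "(x powr (b / 10)) ^ 3 = x powr (3 * b / 10)" for x :: real
      by (simp add: power3_eq_cube flip: powr_add)
    ultimately show ?thesis by (simp only:)
  qed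
  ultimately show ?thesis
  proof eventually_elim
    case (elim x)
    show ?case
    proof (intro allI impI)
      fix N :: nat assume N: "x powr (3 / 10) \<le> real N \<and> real N \<le> x powr (2 / 5)"
      have "1 \<le> x powr (3 / 10)" using elim(1) by (simp add: ge_one_powr_ge_zero)
      with N have N1: "1 \<le> real N" by linarith
      define Q where "Q = nat \<lfloor>exp (real N powr b)\<rfloor>"
      have e1: "exp (real N powr b) \<ge> 1" by simp
      have Q_le: "real Q \<le> exp (real N powr b)" unfolding Q_def using e1 by simp
      have Q_pos: "Q > 0" unfolding Q_def using e1 by simp
      have Q_ge: "exp (real N powr b) \<le> 2 * real Q"
        using Q_pos unfolding Q_def by linarith
      have "real (Q ^ N) \<le> exp (real N powr b) ^ N"
        using power_mono[OF Q_le] by simp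
      also have "\<dots> = exp (real N powr (1 + b))"
        using N1 by (simp add: powr_add flip: exp_of_nat_mult)
      finally have 1: "real (Q ^ N) \<le> exp (real N powr (1 + b))" .
      have "real N powr (1 + b) \<le> real N powr 2"
        using N1 \<open>b \<le> 1\<close> by (intro powr_mono) auto
      also have "\<dots> \<le> (x powr (2 / 5)) powr 2"
        using N by (intro powr_mono2) auto
      also have "\<dots> = x powr (4 / 5)"
        by (simp add: powr_powr)
      finally have 2: "real (Q ^ N) \<le> exp (x / 2) / 2"
        using 1 elim(2) by (smt (verit) exp_le_cancel_iff)
      have "2 * pi / real Q \<le> 2 * pi / (exp (real N powr b) / 2)"
        by (intro divide_left_mono) (use Q_ge Q_pos in auto)
      also have "\<dots> = 4 * pi * exp (- (real N powr b))"
        by (simp add: exp_minus field_simps)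
      also have "\<dots> \<le> 4 * pi * exp (- (x powr (3 * b / 10)))"
      proof -
        have "(x powr (3 / 10)) powr b \<le> real N powr b"
          using N \<open>0 < b\<close> by (intro powr_mono2) auto
        thus ?thesis by (simp add: powr_powr)
      qed
      also note elim(3)
      finally have 3: "2 * pi / real Q \<le> exp (- (x powr (b / 10)))" .
      show "N > 0 \<and> (\<exists>Q > 0. real (Q ^ N) \<le> exp (real N powr (1 + b)) \<and>
             real (Q ^ N) \<le> exp (x / 2) / 2 \<and> 2 * pi / real Q \<le> exp (- (x powr (b / 10))))"
        using N1 Q_pos 1 2 3 by (intro conjI exI[of _ Q]) auto
    qed
  qed
qed

definition good_shift :: "real \<Rightarrow> nat \<Rightarrow> real \<times> real \<Rightarrow> bool" where
  "good_shift b n \<tau> \<longleftrightarrow>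
     (\<forall>l\<in>Lam n. cmod (phase l \<tau> - 1) \<le> exp (- (ln (real n) powr (b / 10)))) \<and>
     1 \<le> sqrt (real n) * torus_norm \<tau> \<and>
     torus_norm \<tau> \<le> exp (real (NN n) powr (1 + b)) * real n powr (- 1 / 2)"

lemma eventually_good_shift:
  assumes "0 < b" "b \<le> 1"
    and NN: "\<forall>\<^sub>F n in along A. ln (real n) powr (3 / 10) \<le> real (NN n) \<and>
                               real (NN n) \<le> ln (real n) powr (2 / 5)"
  shows "\<forall>\<^sub>F n in along A. NN n > 0 \<and> (\<exists>\<tau>. good_shift b n \<tau>)"
proof -
  let ?P = "\<lambda>n. \<forall>N :: nat.
        ln (real n) powr (3 / 10) \<le> real N \<and> real N \<le> ln (real n) powr (2 / 5) \<longrightarrow>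
        N > 0 \<and> (\<exists>Q > 0. real (Q ^ N) \<le> exp (real N powr (1 + b)) \<and>
          real (Q ^ N) \<le> exp (ln (real n) / 2) / 2 \<and>
          2 * pi / real Q \<le> exp (- (ln (real n) powr (b / 10))))"
  have "filterlim (\<lambda>n. ln (real n)) at_top sequentially" by real_asymp
  from eventually_compose_filterlim[OF pigeonhole_parameter[OF assms(1,2)] this]
  have "\<forall>\<^sub>F n in sequentially. n > 0 \<and> ?P n"
    using eventually_gt_at_top[of 0] by eventually_elim simp
  hence "\<forall>\<^sub>F n in along A. n > 0 \<and> ?P n"
    unfolding eventually_along by (rule eventually_mono) blast
  with NN show ?thesis
  proof eventually_elim
    case (elim n)
    then obtain Q where "n > 0" "NN n > 0" "Q > 0"
      and Q1: "real (Q ^ NN n) \<le> exp (real (NN n) powr (1 + b))"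
      and Q2: "real (Q ^ NN n) \<le> exp (ln (real n) / 2) / 2"
      and Q3: "2 * pi / real Q \<le> exp (- (ln (real n) powr (b / 10)))"
      by blast
    define s where "s = sqrt (real n)"
    have "s > 0" using \<open>n > 0\<close> by (simp add: s_def)
    have s_exp: "exp (ln (real n) / 2) = s"
      using \<open>n > 0\<close> by (simp add: s_def powr_half_sqrt[symmetric] powr_def)
    have s_powr: "real n powr (- 1 / 2) = 1 / s"
      using powr_minus[of "real n" "1 / 2"]
      by (simp only: s_def powr_half_sqrt[OF of_nat_0_le_iff] divide_minus_left inverse_eq_divide)
    obtain m where m: "1 \<le> m" "m \<le> Q ^ NN n"
      and phases: "\<And>l. l \<in> Lam n \<Longrightarrow> cmod (phase l (real m *\<^sub>R (1 / s, 0)) - 1) \<le> 2 * pi / real Q"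
      unfolding NN_def using common_near_period[OF finite_Lam \<open>Q > 0\<close>] by blast
    have m_le: "real m \<le> real (Q ^ NN n)" using m(2) by (simp only: of_nat_le_iff)
    with Q2 have "2 * real m \<le> s" unfolding s_exp by linarith
    hence "torus_norm (real m / s, 0) = real m / s"
      using \<open>s > 0\<close> by (intro torus_norm_horizontal) (simp_all add: field_simps)
    hence "good_shift b n (real m / s, 0)"
      unfolding good_shift_def s_powr s_def[symmetric]
      using phases Q3 m(1) divide_right_mono[OF order_trans[OF m_le Q1], of s] \<open>s > 0\<close>
      by (auto intro: order_trans)
    with \<open>NN n > 0\<close> show ?case by blast
  qed
qed

lemma powr_times_exp_minus_powr_tendsto_0:
  fixes c k :: real
  assumes "k > 0"
  shows "((\<lambda>x. x powr c * exp (- (x powr k))) \<longlongrightarrow> 0) at_top"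
proof -
  have "((\<lambda>y :: real. y powr (c / k) * exp (- y)) \<longlongrightarrow> 0) at_top"
    by real_asymp
  moreover have "filterlim (\<lambda>x :: real. x powr k) at_top at_top"
    using assms by real_asymp
  ultimately have "((\<lambda>x. (x powr k) powr (c / k) * exp (- (x powr k))) \<longlongrightarrow> 0) at_top"
    by (rule filterlim_compose)
  thus ?thesis using assms by (simp add: powr_powr)
qed

theorem theorem2p1:
  fixes S' :: "nat set"
    and M :: "'w measure"
    and a :: "int \<times> int \<Rightarrow> 'w \<Rightarrow> complex"
    and \<alpha> :: real
  assumes "S' \<subseteq> sums_of_two_squares"
    and "relative_density_one S' sums_of_two_squares"
    and "\<exists>h :: nat \<Rightarrow> real. (h \<longlongrightarrow> 0) (along S') \<and>
           (\<forall>\<^sub>F n in along S'. real (NN n) = ln (real n) powr (ln 2 / 2 + h n))"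
    and "converges_weakly empirical_measure circle_measure (along S')"
    and "\<And>\<rho>. \<rho> < ln (pi / 2) / 2 \<Longrightarrow>
           \<forall>\<^sub>F n in along S'. arc_discrepancy n \<le> ln (real n) powr (- \<rho>)"
    and "\<And>n. n \<in> S' \<Longrightarrow> n > 0 \<Longrightarrow> wave_coefficients M a n"
    and "\<alpha> > 0"
  shows "\<exists>\<kappa>>0. \<exists>\<tau> :: nat \<Rightarrow> real \<times> real.
           almost_periods S' M a \<tau> \<and>
           (\<forall>\<^sub>F n in along S'.
              torus_norm (\<tau> n) \<le> exp (real (NN n) powr (1 + \<alpha>)) * real n powr (- 1 / 2) \<and>
              cov_shift n (\<tau> n) \<le> exp (- (ln (real n) powr \<kappa>)))"
proof -
  define b where "b = min \<alpha> 1"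
  have b: "0 < b" "b \<le> 1" "b \<le> \<alpha>" using \<open>\<alpha> > 0\<close> by (auto simp: b_def)
  define \<kappa> where "\<kappa> = b / 10"
  have "\<kappa> > 0" using b by (simp add: \<kappa>_def)
  define \<delta> where "\<delta> n = exp (- (ln (real n) powr \<kappa>))" for n
  define \<tau> where "\<tau> n = (SOME t. good_shift b n t)" for n
  have NN_bounds: "\<forall>\<^sub>F n in along S'. ln (real n) powr (3 / 10) \<le> real (NN n) \<and>
                                      real (NN n) \<le> ln (real n) powr (2 / 5)"
    using assms(3) NN_polylog_bounds by blast
  have \<tau>: "\<forall>\<^sub>F n in along S'. NN n > 0 \<and> good_shift b n (\<tau> n)"
    using eventually_good_shift[OF b(1,2) NN_bounds]
    by (rule eventually_mono) (auto simp: \<tau>_def intro: someI)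

  have size_and_cov: "\<forall>\<^sub>F n in along S'.
      torus_norm (\<tau> n) \<le> exp (real (NN n) powr (1 + \<alpha>)) * real n powr (- 1 / 2) \<and>
      cov_shift n (\<tau> n) \<le> \<delta> n"
    using \<tau>
  proof eventually_elim
    case (elim n)
    have "real (NN n) powr (1 + b) \<le> real (NN n) powr (1 + \<alpha>)"
      using elim b by (intro powr_mono) auto
    hence "exp (real (NN n) powr (1 + b)) * real n powr (- 1 / 2)
        \<le> exp (real (NN n) powr (1 + \<alpha>)) * real n powr (- 1 / 2)"
      by (intro mult_right_mono) auto
    moreover have "cov_shift n (\<tau> n) \<le> \<delta> n"
      using elim by (intro cov_shift_le) (auto simp: good_shift_def \<delta>_def \<kappa>_def)
    ultimately show ?case
      using elim by (auto simp: good_shift_def)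
  qed

  have "almost_periods S' M a \<tau>"
    unfolding almost_periods_def
  proof
    have "\<forall>\<^sub>F n in along S'. 1 \<le> ereal (sqrt (real n) * torus_norm (\<tau> n))"
      using \<tau> by (rule eventually_mono) (simp add: good_shift_def)
    thus "1 \<le> Liminf (along S') (\<lambda>n. ereal (sqrt (real n) * torus_norm (\<tau> n)))"
      by (rule Liminf_bounded)
  next
    show "AE \<omega> in M. ((\<lambda>n. SUP t. cmod (random_wave a n \<omega> (t + \<tau> n) - random_wave a n \<omega> t))
            \<longlongrightarrow> 0) (along S')"
    proof (cases "\<exists>n\<in>S'. n > 0")
      case False
      \<comment> \<open>nothing is then known about \<open>M\<close>, but there is no limit to take\<close>
      hence "\<forall>\<^sub>F n in along S'. False"
        unfolding eventually_along using eventually_gt_at_top[of 0] by eventually_elim (use False in auto)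
      hence "along S' = bot" by (simp add: trivial_limit_def)
      thus ?thesis by simp
    next
      case True
      then interpret prob_space M
        using assms(6) by (auto simp: wave_coefficients_def)
      have "AE \<omega> in M. \<forall>\<^sub>F n in along S'. \<forall>l\<in>Lam n. cmod (a l \<omega>) \<le> 4 * sqrt (ln (real n))"
        by (rule AE_eventually_coefficients_le)
          (use assms(6) in \<open>fastforce simp: wave_coefficients_def\<close>)
      thus ?thesis
      proof (rule AE_mp, intro AE_I2 impI)
        fix \<omega>
        assume coeffs: "\<forall>\<^sub>F n in along S'. \<forall>l\<in>Lam n. cmod (a l \<omega>) \<le> 4 * sqrt (ln (real n))"
        let ?D = "\<lambda>n t. cmod (random_wave a n \<omega> (t + \<tau> n) - random_wave a n \<omega> t)"
        define C where "C n = 4 * (ln (real n) powr (7 / 10) * \<delta> n)" for n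
        have "filterlim (\<lambda>n. ln (real n)) at_top sequentially" by real_asymp
        from tendsto_mult_right_zero[OF
          filterlim_compose[OF powr_times_exp_minus_powr_tendsto_0[OF \<open>\<kappa> > 0\<close>] this]]
        have C: "(C \<longlongrightarrow> 0) sequentially"
          unfolding C_def \<delta>_def .
        have bound: "\<forall>\<^sub>F n in along S'. (SUP t. ?D n t) \<in> {0..C n}"
          using \<tau> NN_bounds coeffs
        proof eventually_elim
          case (elim n)
          have D_le: "?D n t \<le> C n" for t
          proof -
            have "?D n t \<le> sqrt (real (NN n)) * (4 * sqrt (ln (real n))) * \<delta> n"
              using elim by (intro random_wave_shift_le) (auto simp: good_shift_def \<delta>_def \<kappa>_def)
            also have "\<dots> \<le> C n"
            proof -
              have "0 < card (Lam n)" using elim by (simp add: NN_def)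
              then obtain l where "l \<in> Lam n" by (metis card_gt_0_iff ex_in_conv)
              hence "0 \<le> 4 * sqrt (ln (real n))"
                using elim(3) order_trans[OF norm_ge_zero] by blast
              hence ln: "0 \<le> ln (real n)" by simp
              have "sqrt (real (NN n)) * sqrt (ln (real n))
                  \<le> sqrt (ln (real n) powr (2 / 5)) * sqrt (ln (real n))"
                using elim ln by (intro mult_right_mono) auto
              also have "\<dots> = ln (real n) powr (1 / 5) * ln (real n) powr (1 / 2)"
                using ln by (simp add: powr_half_sqrt[symmetric] powr_powr)
              also have "\<dots> = ln (real n) powr (7 / 10)"
                by (simp flip: powr_add)
              finally have "4 * (sqrt (real (NN n)) * sqrt (ln (real n)) * \<delta> n) \<le> C n"
                unfolding C_def by (intro mult_left_mono mult_right_mono) (auto simp: \<delta>_def)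
              thus ?thesis by (simp add: mult_ac)
            qed
            finally show ?thesis .
          qed
          have "bdd_above (range (?D n))" using D_le by (rule bdd_aboveI2)
          from cSUP_upper[OF UNIV_I this] have "?D n 0 \<le> (SUP t. ?D n t)" .
          moreover have "(SUP t. ?D n t) \<le> C n" using D_le by (intro cSUP_least) auto
          ultimately show ?case using order_trans[OF norm_ge_zero] by simp
        qed
        have "(C \<longlongrightarrow> 0) (along S')"
          using C unfolding along_def by (rule tendsto_mono[rotated]) simp
        thus "((\<lambda>n. SUP t. ?D n t) \<longlongrightarrow> 0) (along S')"
          by (rule tendsto_sandwich[OF _ _ tendsto_const, rotated 2])
            (use bound in \<open>auto elim: eventually_mono\<close>)
      qed
    qed
  qed
  with size_and_cov \<open>\<kappa> > 0\<close> show ?thesis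
    unfolding \<delta>_def by blast
qed

end
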